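(* In the fixed-base chain setting of the context, let $i\in\{1,\ldots,N\}$ and suppose $\mathbf{V}_{i-1}$ is a matrix with $\mathrm{Range}(\mathbf{V}_{i-1})=\mathcal{V}_{i-1}$ (for $i=1$ one may take $\mathbf{V}_0=\mathbf{0}_{6\times1}$). Let ${}^{J_i}\mathbf{V}_{i-1}={}^{J_i}\mathbf{X}_{i-1}\mathbf{V}_{i-1}$. Then the matrix $$\mathbf{V}_i=\Big[\ {}^{J_i}\mathbf{V}_{i-1},\ (\boldsymbol{\Phi}_i\times){}^{J_i}\mathbf{V}_{i-1},\ \ldots,\ (\boldsymbol{\Phi}_i\times)^5\,{}^{J_i}\mathbf{V}_{i-1},\ \ \boldsymbol{\Phi}_i\ \Big]$$ (i.e. the controllability matrix of the pair $((\boldsymbol\Phi_i\times),{}^{J_i}\mathbf V_{i-1})$ augmented by the column $\boldsymbol\Phi_i$) satisfies $\mathrm{Range}(\mathbf{V}_i)=\mathcal{V}_i$.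
   Context: Spatial notation. For $\mathbf{x}\in\mathbb{R}^3$, $\mathbf{S}(\mathbf{x})$ is the skew-symmetric matrix with $\mathbf{S}(\mathbf{x})\mathbf{y}=\mathbf{x}\times\mathbf{y}$. For $\mathbf{v}=[\boldsymbol{\omega};\mathbf{u}]\in\mathbb{R}^6$, $(\mathbf{v}\times)=\begin{bmatrix}\mathbf{S}(\boldsymbol{\omega})&\mathbf{0}\\ \mathbf{S}(\mathbf{u})&\mathbf{S}(\boldsymbol{\omega})\end{bmatrix}$. A spatial transform is a matrix $\begin{bmatrix}\mathbf{R}&\mathbf{0}\\-\mathbf{R}\mathbf{S}(\mathbf{p})&\mathbf{R}\end{bmatrix}$ with $\mathbf{R}\in SO(3)$, $\mathbf{p}\in\mathbb{R}^3$. Fixed-base chain. Body $0$ is the fixed ground with $\mathbf{v}_0=\mathbf{0}$. For $i=1,\ldots,N$, joint $i$ has coordinate $q_i\in\mathbb{R}$ and $\mathbf{v}_i={}^{i}\mathbf{X}_{i-1}(q_i)\mathbf{v}_{i-1}+\boldsymbol{\Phi}_i\dot q_i$, where $\boldsymbol{\Phi}_i\in\mathbb{R}^6$ is fixed, ${}^{i}\mathbf{X}_{i-1}(q_i)={}^{i}\mathbf{X}_{J_i}(q_i)\,{}^{J_i}\mathbf{X}_{i-1}$, ${}^{J_i}\mathbf{X}_{i-1}$ is a constant spatial transform, and ${}^{i}\mathbf{X}_{J_i}(q_i)$ is a spatial transform with ${}^{i}\mathbf{X}_{J_i}(0)=\mathbf{1}_6$ and $\frac{d}{dq_i}{}^{i}\mathbf{X}_{J_i}(q_i)=-(\boldsymbol{\Phi}_i\times){}^{i}\mathbf{X}_{J_i}(q_i)$.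 The attainable velocity span of body $i$ is $\mathcal{V}_i=\mathrm{span}\{\mathbf{v}_i(\mathbf{q},\dot{\mathbf{q}}):\mathbf{q},\dot{\mathbf{q}}\in\mathbb{R}^N\}\subseteq\mathbb{R}^6$, with $\mathcal V_0=\{\mathbf 0\}$. *)

theory Defs
  imports "HOL-Analysis.Analysis"
begin

text \<open>Spatial vectors are elements of real^6; components 1..3 form the angular part
  omega, components 4..6 the linear part u.\<close>

definition ang :: "real^6 \<Rightarrow> real^3" where
  "ang v = vector [v$1, v$2, v$3]"

definition lin :: "real^6 \<Rightarrow> real^3" where
  "lin v = vector [v$4, v$5, v$6]"

definition spv :: "real^3 \<Rightarrow> real^3 \<Rightarrow> real^6" where
  "spv w u = vector [w$1, w$2, w$3, u$1, u$2, u$3]"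

text \<open>Skew-symmetric matrix S(x) with S(x) y = x \<times> y.\<close>
definition skew :: "real^3 \<Rightarrow> real^3^3" where
  "skew x = matrix (\<lambda>y. cross3 x y)"

text \<open>Block 6x6 matrix [[A, B], [C, D]] with 3x3 blocks.\<close>
definition blk :: "real^3^3 \<Rightarrow> real^3^3 \<Rightarrow> real^3^3 \<Rightarrow> real^3^3 \<Rightarrow> real^6^6" where
  "blk A B C D = matrix (\<lambda>y. spv (A *v ang y + B *v lin y) (C *v ang y + D *v lin y))"

text \<open>Spatial cross-product matrix (v\<times>) = [[S(omega), 0], [S(u), S(omega)]].\<close>
definition crossm :: "real^6 \<Rightarrow> real^6^6" where
  "crossm v = blk (skew (ang v)) 0 (skew (lin v)) (skew (ang v))"

definition SO3 :: "(real^3^3) set" where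
  "SO3 = {R. orthogonal_matrix R \<and> det R = 1}"

text \<open>Spatial transform [[R, 0], [-R S(p), R]] with R in SO(3).\<close>
definition is_spatial_transform :: "real^6^6 \<Rightarrow> bool" where
  "is_spatial_transform X \<longleftrightarrow>
     (\<exists>R p. R \<in> SO3 \<and> X = blk R 0 (- (R ** skew p)) R)"

text \<open>Body velocities of the fixed-base chain: v_0 = 0,
  v_i = (iXJi(q_i) JiX(i-1)) v_(i-1) + Phi_i qdot_i.\<close>
primrec vel :: "(nat \<Rightarrow> real \<Rightarrow> real^6^6) \<Rightarrow> (nat \<Rightarrow> real^6^6) \<Rightarrow> (nat \<Rightarrow> real^6)
    \<Rightarrow> nat \<Rightarrow> (nat \<Rightarrow> real) \<Rightarrow> (nat \<Rightarrow> real) \<Rightarrow> real^6" where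
  "vel XJ XT Phi 0 q qd = 0"
| "vel XJ XT Phi (Suc n) q qd =
     (XJ (Suc n) (q (Suc n)) ** XT (Suc n)) *v vel XJ XT Phi n q qd + qd (Suc n) *\<^sub>R Phi (Suc n)"

text \<open>Attainable velocity span of body i (joint coordinates q_1..q_N, qdot_1..qdot_N are the
  values of q, qd at 1..N; v_i only depends on the entries 1..i).\<close>
definition attainable :: "nat \<Rightarrow> (nat \<Rightarrow> real \<Rightarrow> real^6^6) \<Rightarrow> (nat \<Rightarrow> real^6^6) \<Rightarrow> (nat \<Rightarrow> real^6)
    \<Rightarrow> nat \<Rightarrow> (real^6) set" where
  "attainable N XJ XT Phi i = span {vel XJ XT Phi i q qd | q qd. True}"

text \<open>Range (column space) of a matrix.\<close>
definition Range :: "real^'k^'m \<Rightarrow> (real^'m) set" where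
  "Range M = {M *v x | x. True}"

text \<open>The controllability matrix [W, A W, ..., A^5 W] augmented by the column phi.
  Column (j, c) (j ranges over the six elements 0..5 of type 6) is column c of A^j W;
  the extra column Inr is phi.\<close>
definition augctrl :: "real^6^6 \<Rightarrow> real^6 \<Rightarrow> real^'k^6 \<Rightarrow> real^((6 \<times> 'k) + 1)^6" where
  "augctrl A phi W = (\<chi> r s. case s of
       Inl (j, c) \<Rightarrow> ((((**) A) ^^ nat (Rep_bit0 j)) W) $ r $ c
     | Inr _ \<Rightarrow> phi $ r)"

end

theory Submission
  imports Defs
begin

text \<open>With \<open>A = (\<Phi>\<^sub>i\<times>)\<close>, the joint transform \<open>X t\<close> solves \<open>X' = - A X\<close>, \<open>X 0 = 1\<close>,
  i.e. it is \<open>exp (- t A)\<close>, and \<open>\<V>\<^sub>i\<close> is spanned by \<open>\<Phi>\<^sub>i\<close> together with the orbits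
  \<open>X t w\<close> of the vectors \<open>w\<close> in the image \<open>W\<close> of \<open>\<V>\<^sub>i\<^sub>-\<^sub>1\<close> under the constant transform. The span of these orbits is the Krylov space
  \<open>K = span {A\<^sup>j w | j < 6, w \<in> W}\<close>, which is the range of the controllability matrix.
  Differentiating \<open>t \<mapsto> L (X t w)\<close> at \<open>0\<close> shows that a linear map vanishing on all orbits
  vanishes on every \<open>A\<^sup>j w\<close>. Conversely, the Krylov chain in \<open>\<real>\<^sup>6\<close> stabilises within six steps,
  so \<open>K\<close> is \<open>A\<close>-invariant; then the component of \<open>X t w\<close> transverse to \<open>K\<close> solves a linear
  ODE with zero initial value and vanishes by a Gronwall-type estimate.
  Only the differential equation and the initial value of the joint transforms enter.\<close>

lemma linear_ode_zero_nonneg: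
  fixes z :: "real \<Rightarrow> 'a::euclidean_space" and L :: "'a \<Rightarrow> 'a"
  assumes lin: "linear L" and d: "\<And>t. (z has_vector_derivative L (z t)) (at t)"
    and z0: "z 0 = 0" and t: "t \<ge> 0"
  shows "z t = 0"
proof -
  obtain c where c: "c > 0" "\<And>x. norm (L x) \<le> c * norm x"
    using linear_bounded_pos[OF lin] by blast
  define F where "F s = (z s \<bullet> z s) * exp (-(2*c) * s)" for s
  have dF: "(F has_real_derivative (2 * (z s \<bullet> L (z s)) - 2*c*(z s \<bullet> z s)) * exp (-(2*c) * s)) (at s)" for s
  proof -
    have "((\<lambda>s. z s \<bullet> z s) has_vector_derivative (z s \<bullet> L (z s) + L (z s) \<bullet> z s)) (at s)"
      using bounded_bilinear.has_vector_derivative[OF bounded_bilinear_inner d d] by simp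
    then have norm2: "((\<lambda>s. z s \<bullet> z s) has_real_derivative 2 * (z s \<bullet> L (z s))) (at s)"
      by (simp add: has_real_derivative_iff_has_vector_derivative inner_commute)
    show ?thesis unfolding F_def
      by (rule derivative_eq_intros norm2 refl | simp)+ (simp add: algebra_simps)
  qed
  have dF_nonpos: "(2 * (z s \<bullet> L (z s)) - 2*c*(z s \<bullet> z s)) * exp (-(2*c) * s) \<le> 0" for s
  proof -
    have "z s \<bullet> L (z s) \<le> norm (z s) * norm (L (z s))"
      by (rule Cauchy_Schwarz_ineq2[THEN order_trans[OF abs_ge_self]])
    also have "\<dots> \<le> norm (z s) * (c * norm (z s))" by (rule mult_left_mono[OF c(2)]) simp
    also have "\<dots> = c * (z s \<bullet> z s)" by (simp add: power2_norm_eq_inner[symmetric] power2_eq_square)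
    finally show ?thesis by (simp add: mult_nonpos_nonneg)
  qed
  have "F t \<le> F 0"
    by (rule DERIV_nonpos_imp_nonincreasing[OF t]) (use dF dF_nonpos in blast)
  then have "z t \<bullet> z t \<le> 0" using z0 by (simp add: F_def mult_le_0_iff)
  then show ?thesis by (metis inner_ge_zero inner_eq_zero_iff order_antisym)
qed

lemma linear_ode_zero:
  fixes z :: "real \<Rightarrow> 'a::euclidean_space" and L :: "'a \<Rightarrow> 'a"
  assumes lin: "linear L" and d: "\<And>t. (z has_vector_derivative L (z t)) (at t)"
    and z0: "z 0 = 0"
  shows "z t = 0"
proof (cases "t \<ge> 0")
  case True
  then show ?thesis using linear_ode_zero_nonneg[OF lin d z0] by blast
next
  case False
  define w where "w s = z (- s)" for s
  have lin_neg: "linear (\<lambda>x. - L x)" using lin by (simp add: linear_compose_neg)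
  have dw: "(w has_vector_derivative - L (w s)) (at s)" for s
  proof -
    have "((z \<circ> uminus) has_vector_derivative ((-1) *\<^sub>R L (z (- s)))) (at s)"
      by (rule vector_diff_chain_at) (auto intro!: derivative_eq_intros d)
    then show ?thesis by (simp add: w_def[abs_def] o_def)
  qed
  have "w (- t) = 0"
    by (rule linear_ode_zero_nonneg[OF lin_neg dw]) (use z0 False in \<open>auto simp: w_def\<close>)
  then show ?thesis by (simp add: w_def)
qed

lemma complementary_projection:
  fixes K :: "'a::euclidean_space set"
  assumes "subspace K"
  obtains P where "linear P" "\<And>x. x - P x \<in> K" "\<And>k. k \<in> K \<Longrightarrow> P k = 0"
proof -
  obtain B where B: "B \<subseteq> K" "pairwise orthogonal B" "span B = K"
    using orthogonal_basis_subspace[OF assms] by metis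
  define Q where "Q x = (\<Sum>b\<in>B. (b \<bullet> x / (b \<bullet> b)) *\<^sub>R b)" for x
  define P where "P x = x - Q x" for x
  have "linear Q" unfolding Q_def
    by (rule linearI) (simp_all add: inner_add_right add_divide_distrib scaleR_add_left sum.distrib
        scaleR_sum_right)
  then have "linear P" unfolding P_def by (simp add: linear_compose_sub linear_id[unfolded id_def])
  moreover have QK: "Q x \<in> K" for x
    unfolding Q_def using B by (metis (no_types, lifting) span_base span_mul span_sum subsetD)
  then have "x - P x \<in> K" for x by (simp add: P_def)
  moreover have "P k = 0" if "k \<in> K" for k
  proof -
    have "P k \<in> K" unfolding P_def using that QK by (simp add: assms subspace_diff)
    then have "orthogonal (P k) (P k)"
      using Gram_Schmidt_step[OF B(2), of "P k" k] B(3) by (simp add: P_def Q_def)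
    then show ?thesis by (simp add: orthogonal_def)
  qed
  ultimately show ?thesis using that by blast
qed

lemma matrix_vector_mult_uminus: "(- (M::real^'n^'m)) *v x = - (M *v x)"
  using matrix_vector_mult_diff_rdistrib[of 0 M x] by simp

lemma bounded_linear_matrix_vector_mult_left: "bounded_linear (\<lambda>M::real^'n^'m. M *v x)"
proof -
  have "linear (\<lambda>M::real^'n^'m. M *v x)"
    by (rule linearI) (simp_all add: matrix_vector_mult_add_rdistrib scaleR_matrix_vector_assoc)
  then show ?thesis by (simp add: linear_conv_bounded_linear)
qed

lemma linear_matrix_vector_mult_funpow: "linear (((*v) (A::real^'n^'n)) ^^ j)"
proof (induction j)
  case 0
  then show ?case by (simp add: linear_id[unfolded id_def])
next
  case (Suc j)
  then show ?case
    unfolding funpow.simps(2) by (rule linear_compose[OF _ matrix_vector_mul_linear])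
qed

lemma matrix_mult_funpow_vector:
  fixes A :: "real^'n^'n" and M :: "real^'k^'n"
  shows "((((**) A) ^^ j) M) *v x = (((*v) A) ^^ j) (M *v x)"
  by (induction j) (simp_all add: matrix_vector_mul_assoc[symmetric])

lemma matrix_flow_preserves_invariant_subspace:
  fixes X :: "real \<Rightarrow> real^'n^'n" and A :: "real^'n^'n"
  assumes K: "subspace K" and AK: "\<And>x. x \<in> K \<Longrightarrow> A *v x \<in> K"
    and dX: "\<And>t. (X has_vector_derivative (- (A ** X t))) (at t)" and X0: "X 0 = mat 1"
    and k: "k \<in> K"
  shows "X t *v k \<in> K"
proof -
  obtain P where P: "linear P" "\<And>x. x - P x \<in> K" "\<And>k. k \<in> K \<Longrightarrow> P k = 0"
    using complementary_projection[OF K] by metis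
  define z where "z s = P (X s *v k)" for s
  have PA: "P (A *v y) = P (A *v P y)" for y
  proof -
    have "P (A *v y) = P (A *v (y - P y)) + P (A *v P y)"
      by (simp add: matrix_vector_right_distrib[symmetric] linear_add[OF P(1), symmetric])
    then show ?thesis using P(3)[OF AK[OF P(2)]] by simp
  qed
  text \<open>Since \<open>A\<close> preserves \<open>K = ker P\<close>, the component \<open>z\<close> of the orbit transverse to \<open>K\<close>
    solves a linear ODE of its own.\<close>
  have dz: "(z has_vector_derivative - P (A *v z s)) (at s)" for s
  proof -
    have "((\<lambda>s. X s *v k) has_vector_derivative (- (A ** X s)) *v k) (at s)"
      by (rule bounded_linear.has_vector_derivative[OF bounded_linear_matrix_vector_mult_left dX])
    then have "(z has_vector_derivative P ((- (A ** X s)) *v k)) (at s)"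
      unfolding z_def[abs_def]
      by (rule bounded_linear.has_vector_derivative[OF linear_conv_bounded_linear[THEN iffD1, OF P(1)]])
    moreover have "P ((- (A ** X s)) *v k) = - P (A *v z s)"
      using PA[of "X s *v k"]
      by (simp add: z_def matrix_vector_mult_uminus matrix_vector_mul_assoc linear_neg[OF P(1)])
    ultimately show ?thesis by simp
  qed
  have "linear (\<lambda>y. - P (A *v y))"
    by (intro linear_compose_neg linear_compose[OF matrix_vector_mul_linear P(1), unfolded o_def])
  then have "z t = 0"
    by (rule linear_ode_zero[OF _ dz]) (simp add: z_def X0 P(3)[OF k])
  then show ?thesis using P(2)[of "X t *v k"] by (simp add: z_def)
qed

lemma matrix_flow_annihilator_powers:
  fixes X :: "real \<Rightarrow> real^'n^'n" and A :: "real^'n^'n" and L :: "real^'n \<Rightarrow> 'a::real_normed_vector"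
  assumes dX: "\<And>t. (X has_vector_derivative (- (A ** X t))) (at t)" and X0: "X 0 = mat 1"
    and "linear L" and "\<And>t. L (X t *v w) = 0"
  shows "L ((((*v) A) ^^ j) w) = 0"
  using assms(3,4)
proof (induction j arbitrary: L)
  case 0
  then show ?case using X0 by (metis funpow_0 matrix_vector_mul_lid)
next
  case (Suc j)
  text \<open>Differentiating \<open>L (X t w) = 0\<close> shows that \<open>L \<circ> (*v) A\<close> annihilates the orbit too.\<close>
  have "L (A *v (X t *v w)) = 0" for t
  proof -
    have "((\<lambda>s. L (X s *v w)) has_vector_derivative L ((- (A ** X t)) *v w)) (at t)"
      using Suc.prems(1) by (intro bounded_linear.has_vector_derivative[OF _ dX])
        (simp add: linear_conv_bounded_linear bounded_linear_compose[OF _ bounded_linear_matrix_vector_mult_left])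
    moreover have "((\<lambda>s. L (X s *v w)) has_vector_derivative 0) (at t)"
      using Suc.prems(2) by simp
    ultimately have "L ((- (A ** X t)) *v w) = 0"
      by (rule vector_derivative_unique_at)
    then show ?thesis
      using Suc.prems(1) by (simp add: matrix_vector_mult_uminus matrix_vector_mul_assoc linear_neg)
  qed
  then have "L (A *v (((*v) A ^^ j) w)) = 0"
    using Suc.IH[of "\<lambda>x. L (A *v x)"] Suc.prems(1)
    by (simp add: linear_compose[OF matrix_vector_mul_linear, unfolded o_def])
  then show ?case by simp
qed

lemma span_Un_span: "span (S \<union> span T) = span (S \<union> T)"
  by (simp add: span_Un span_span)

lemma span_UN_span: "span (\<Union>i\<in>I. span (C i)) = span (\<Union>i\<in>I. C i)"
proof
  show "span (\<Union>i\<in>I. C i) \<subseteq> span (\<Union>i\<in>I. span (C i))"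
    by (intro span_mono UN_mono span_superset order_refl)
  have "span (C i) \<subseteq> span (\<Union>i\<in>I. C i)" if "i \<in> I" for i
    using that by (intro span_mono) blast
  then show "span (\<Union>i\<in>I. span (C i)) \<subseteq> span (\<Union>i\<in>I. C i)"
    by (intro span_minimal subspace_span) blast
qed

definition krylov :: "real^'n^'n \<Rightarrow> (real^'n) set \<Rightarrow> nat \<Rightarrow> (real^'n) set" where
  "krylov A W m = span (\<Union>j<m. (((*v) A) ^^ j) ` W)"

lemma krylov_mono: "krylov A W m \<subseteq> krylov A W (Suc m)"
  unfolding krylov_def by (rule span_mono) (force simp: lessThan_Suc)

lemma krylov_Suc: "krylov A W (Suc m) = span (W \<union> (*v) A ` krylov A W m)"
proof -
  have "(\<Union>j<Suc m. (((*v) A) ^^ j) ` W) = W \<union> (*v) A ` (\<Union>j<m. (((*v) A) ^^ j) ` W)"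
    unfolding lessThan_Suc_eq_insert_0 by (simp add: image_UN image_comp)
  moreover have "(*v) A ` krylov A W m = span ((*v) A ` (\<Union>j<m. (((*v) A) ^^ j) ` W))"
    unfolding krylov_def by (rule linear_span_image[symmetric]) (rule matrix_vector_mul_linear)
  ultimately show ?thesis by (simp add: krylov_def span_Un_span)
qed

lemma krylov_stable:
  assumes "krylov A W m = krylov A W (Suc m)"
  shows "krylov A W (m + d) = krylov A W m"
proof (induction d)
  case 0
  then show ?case by simp
next
  case (Suc d)
  have "krylov A W (Suc (m + d)) = krylov A W (Suc m)"
    using Suc.IH by (simp add: krylov_Suc)
  then show ?case using assms by simp
qed

lemma krylov_stabilizes:
  fixes A :: "real^'n^'n"
  shows "\<exists>m\<le>CARD('n). krylov A W m = krylov A W (Suc m)"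
proof (rule ccontr)
  assume no_stab: "\<not> ?thesis"
  have "m \<le> dim (krylov A W m)" if "m \<le> Suc CARD('n)" for m
    using that
  proof (induction m)
    case 0
    then show ?case by simp
  next
    case (Suc m)
    have "krylov A W m \<subset> krylov A W (Suc m)"
      using krylov_mono[of A W m] no_stab Suc.prems by fastforce
    then have "dim (krylov A W m) < dim (krylov A W (Suc m))"
      by (intro dim_psubset) (simp add: krylov_def span_span)
    then show ?case using Suc by simp
  qed
  then have "Suc CARD('n) \<le> dim (krylov A W (Suc CARD('n)))" by simp
  then show False using dim_subset_UNIV_cart[of "krylov A W (Suc CARD('n))"] by simp
qed

text \<open>This replaces Cayley--Hamilton: the Krylov chain stops growing within \<open>n\<close> steps and is
  constant from then on.\<close>

lemma krylov_invariant:
  fixes A :: "real^'n^'n"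
  assumes "x \<in> krylov A W CARD('n)"
  shows "A *v x \<in> krylov A W CARD('n)"
proof -
  obtain m where m: "m \<le> CARD('n)" "krylov A W m = krylov A W (Suc m)"
    using krylov_stabilizes by blast
  have "krylov A W (Suc CARD('n)) = krylov A W CARD('n)"
    using krylov_stable[OF m(2), of "CARD('n) - m"] krylov_stable[OF m(2), of "Suc CARD('n) - m"] m(1)
    by (simp add: Suc_diff_le)
  moreover have "A *v x \<in> krylov A W (Suc CARD('n))"
    using assms by (simp add: krylov_Suc span_base)
  ultimately show ?thesis by simp
qed

lemma krylov_span: "krylov A (span W) m = krylov A W m"
proof
  show "krylov A W m \<subseteq> krylov A (span W) m"
    unfolding krylov_def by (intro span_mono UN_mono image_mono span_superset order_refl)
  have "(((*v) A) ^^ j) ` span W \<subseteq> krylov A W m" if "j < m" for j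
  proof -
    have "(((*v) A) ^^ j) ` span W = span ((((*v) A) ^^ j) ` W)"
      by (simp add: linear_span_image linear_matrix_vector_mult_funpow)
    also have "\<dots> \<subseteq> krylov A W m"
      unfolding krylov_def using that by (intro span_mono) blast
    finally show ?thesis .
  qed
  then show "krylov A (span W) m \<subseteq> krylov A W m"
    unfolding krylov_def[of A "span W"] by (intro span_minimal) (auto simp: krylov_def)
qed

lemma span_matrix_flow_orbits:
  fixes X :: "real \<Rightarrow> real^'n^'n" and A :: "real^'n^'n"
  assumes dX: "\<And>t. (X has_vector_derivative (- (A ** X t))) (at t)" and X0: "X 0 = mat 1"
  shows "span {X t *v w | t w. w \<in> W} = krylov A W CARD('n)"
proof
  have W_sub: "W \<subseteq> krylov A W CARD('n)"
  proof
    fix w assume "w \<in> W"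
    then have "w \<in> (\<Union>j<CARD('n). (((*v) A) ^^ j) ` W)"
      by (intro UN_I[of 0]) auto
    then show "w \<in> krylov A W CARD('n)" unfolding krylov_def by (rule span_base)
  qed
  have K_sub: "subspace (krylov A W CARD('n))" by (simp add: krylov_def)
  have "{X t *v w | t w. w \<in> W} \<subseteq> krylov A W CARD('n)"
  proof clarify
    fix t w assume "w \<in> W"
    then show "X t *v w \<in> krylov A W CARD('n)"
      using W_sub by (intro matrix_flow_preserves_invariant_subspace[OF K_sub krylov_invariant dX X0]) auto
  qed
  then show "span {X t *v w | t w. w \<in> W} \<subseteq> krylov A W CARD('n)"
    using K_sub by (rule span_minimal)
  define K where "K = span {X t *v w | t w. w \<in> W}"
  have K: "subspace K" unfolding K_def by (rule subspace_span)
  then obtain P where P: "linear P" "\<And>x. x - P x \<in> K" "\<And>k. k \<in> K \<Longrightarrow> P k = 0"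
    by (rule complementary_projection) blast
  have "(((*v) A) ^^ j) w \<in> K" if "w \<in> W" for j w
  proof -
    have "X t *v w \<in> K" for t
      unfolding K_def by (rule span_base) (use that in blast)
    then have "P ((((*v) A) ^^ j) w) = 0"
      by (intro matrix_flow_annihilator_powers[OF dX X0 P(1)] P(3))
    then show ?thesis using P(2)[of "(((*v) A) ^^ j) w"] by simp
  qed
  then show "krylov A W CARD('n) \<subseteq> K"
    unfolding krylov_def by (intro span_minimal[OF _ K]) blast
qed

lemma vel_fun_upd: "n < m \<Longrightarrow> vel XJ XT Phi n (q(m := a)) (qd(m := b)) = vel XJ XT Phi n q qd"
  by (induction n) auto

lemma vel_zero_rates: "vel XJ XT Phi n q (\<lambda>_. 0) = 0"
  by (induction n) auto

lemma velocities_Suc: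
  "{vel XJ XT Phi (Suc n) q qd | q qd. True} =
   {(XJ (Suc n) t ** XT (Suc n)) *v v + c *\<^sub>R Phi (Suc n) | v t c.
      v \<in> {vel XJ XT Phi n q qd | q qd. True}}"
proof (intro equalityI subsetI)
  fix x assume "x \<in> {(XJ (Suc n) t ** XT (Suc n)) *v v + c *\<^sub>R Phi (Suc n) | v t c.
      v \<in> {vel XJ XT Phi n q qd | q qd. True}}"
  then obtain t c q qd
    where "x = (XJ (Suc n) t ** XT (Suc n)) *v vel XJ XT Phi n q qd + c *\<^sub>R Phi (Suc n)"
    by blast
  then have "x = vel XJ XT Phi (Suc n) (q(Suc n := t)) (qd(Suc n := c))"
    by (simp add: vel_fun_upd)
  then show "x \<in> {vel XJ XT Phi (Suc n) q qd | q qd. True}" by blast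
qed auto

lemma attainable_Suc:
  "attainable N XJ XT Phi (Suc n) =
   span ({Phi (Suc n)} \<union>
     {XJ (Suc n) t *v w | t w. w \<in> (*v) (XT (Suc n)) ` {vel XJ XT Phi n q qd | q qd. True}})"
  (is "_ = span ({?\<phi>} \<union> ?O)")
proof -
  let ?S = "{vel XJ XT Phi n q qd | q qd. True}"
  let ?G = "{(XJ (Suc n) t ** XT (Suc n)) *v v + c *\<^sub>R ?\<phi> | v t c. v \<in> ?S}"
  have O_eq: "?O = {(XJ (Suc n) t ** XT (Suc n)) *v v | t v. v \<in> ?S}"
    by (auto simp: matrix_vector_mul_assoc[symmetric]; blast)
  have "?G \<subseteq> span ({?\<phi>} \<union> ?O)"
  proof
    fix x assume "x \<in> ?G"
    then obtain v t c where x: "x = (XJ (Suc n) t ** XT (Suc n)) *v v + c *\<^sub>R ?\<phi>" "v \<in> ?S"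
      by blast
    then have "(XJ (Suc n) t ** XT (Suc n)) *v v \<in> span ({?\<phi>} \<union> ?O)"
      unfolding O_eq by (intro span_base) blast
    moreover have "?\<phi> \<in> span ({?\<phi>} \<union> ?O)" by (intro span_base) blast
    ultimately show "x \<in> span ({?\<phi>} \<union> ?O)"
      unfolding x(1) by (intro span_add span_mul)
  qed
  moreover have "{?\<phi>} \<union> ?O \<subseteq> ?G"
  proof -
    have "?\<phi> = (XJ (Suc n) 0 ** XT (Suc n)) *v 0 + 1 *\<^sub>R ?\<phi>" "0 \<in> ?S"
      using vel_zero_rates[of XJ XT Phi n "\<lambda>_. 0", symmetric] by auto
    then have "?\<phi> \<in> ?G" by blast
    moreover have "(XJ (Suc n) t ** XT (Suc n)) *v v \<in> ?G" if "v \<in> ?S" for t v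
    proof -
      have "(XJ (Suc n) t ** XT (Suc n)) *v v = (XJ (Suc n) t ** XT (Suc n)) *v v + 0 *\<^sub>R ?\<phi>"
        by simp
      then show ?thesis using that by blast
    qed
    ultimately show ?thesis unfolding O_eq by blast
  qed
  ultimately show ?thesis
    unfolding attainable_def velocities_Suc by (intro span_minimal span_mono subspace_span antisym)
qed

lemma Range_subspace: "subspace (Range (M::real^'k^'m))"
proof -
  have "Range M = (*v) M ` UNIV" by (auto simp: Range_def)
  then show ?thesis by (simp add: linear_subspace_image matrix_vector_mul_linear subspace_UNIV)
qed

lemma Range_matrix_mult: "Range ((A::real^'m^'n) ** (M::real^'k^'m)) = (*v) A ` Range M"
  by (auto simp: Range_def matrix_vector_mul_assoc[symmetric])

lemma Range_eq_span_columns: "Range (M::real^'k^'m) = span (columns M)"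
proof
  show "Range M \<subseteq> span (columns M)"
    unfolding Range_def using matrix_vector_mult_in_columnspace by blast
  have "column c M \<in> Range M" for c
    unfolding Range_def by (auto intro!: exI[of _ "axis c 1"] simp: matrix_vector_mult_basis)
  then show "span (columns M) \<subseteq> Range M"
    by (intro span_minimal Range_subspace) (auto simp: columns_def)
qed

text \<open>The column index \<open>Inl (j, c)\<close> of \<open>augctrl\<close> refers to the power \<open>nat (Rep_bit0 j)\<close>,
  so the six elements of type \<open>6\<close> enumerate the exponents \<open>0, \<dots>, 5\<close>.\<close>

lemma columns_augctrl:
  fixes A :: "real^6^6" and M :: "real^'k^6"
  shows "columns (augctrl A phi M) = insert phi (\<Union>j<6. columns ((((**) A) ^^ j) M))"
proof (intro equalityI subsetI)
  have col_Inl: "column (Inl (j, c)) (augctrl A phi M) = column c ((((**) A) ^^ nat (Rep_bit0 j)) M)"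
    for j c unfolding column_def augctrl_def by simp
  fix x
  assume "x \<in> columns (augctrl A phi M)"
  then obtain s where x: "x = column s (augctrl A phi M)" by (auto simp: columns_def)
  show "x \<in> insert phi (\<Union>j<6. columns ((((**) A) ^^ j) M))"
  proof (cases s)
    case (Inl jc)
    obtain j c where "jc = (j, c)" by fastforce
    moreover have "nat (Rep_bit0 j) < 6" using Rep_bit0[of j] by (simp add: nat_less_iff)
    ultimately show ?thesis using Inl x col_Inl by (auto simp: columns_def)
  next
    case Inr
    then show ?thesis using x by (simp add: column_def augctrl_def vec_eq_iff)
  qed
next
  fix x
  assume "x \<in> insert phi (\<Union>j<6. columns ((((**) A) ^^ j) M))"
  then consider "x = phi" | j c where "j < 6" "x = column c ((((**) A) ^^ j) M)"
    by (auto simp: columns_def)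
  then show "x \<in> columns (augctrl A phi M)"
  proof cases
    case 1
    then have "x = column (Inr 1) (augctrl A phi M)"
      by (simp add: column_def augctrl_def vec_eq_iff)
    then show ?thesis by (auto simp: columns_def)
  next
    case 2
    then have "nat (Rep_bit0 (Abs_bit0 (int j) :: 6)) = j" by (simp add: Abs_bit0_inverse)
    then have "x = column (Inl (Abs_bit0 (int j), c)) (augctrl A phi M)"
      using 2 by (simp add: column_def augctrl_def)
    then show ?thesis by (auto simp: columns_def)
  qed
qed

lemma Range_augctrl:
  fixes A :: "real^6^6" and M :: "real^'k^6"
  shows "Range (augctrl A phi M) = span ({phi} \<union> krylov A (Range M) 6)"
proof -
  have "(((*v) A) ^^ j) ` Range M = Range ((((**) A) ^^ j) M)" for j
    by (auto simp: Range_def matrix_mult_funpow_vector)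
  then have "(((*v) A) ^^ j) ` Range M = span (columns ((((**) A) ^^ j) M))" for j
    by (simp add: Range_eq_span_columns)
  then have "krylov A (Range M) 6 = span (\<Union>j<6. columns ((((**) A) ^^ j) M))"
    unfolding krylov_def by (simp add: span_UN_span)
  then show ?thesis
    using span_Un_span[of "{phi}" "\<Union>j<6. columns ((((**) A) ^^ j) M)"]
    by (simp add: Range_eq_span_columns[of "augctrl A phi M"] columns_augctrl)
qed

theorem lemma1:
  fixes N i :: nat
    and XJ :: "nat \<Rightarrow> real \<Rightarrow> real^6^6"
    and XT :: "nat \<Rightarrow> real^6^6"
    and Phi :: "nat \<Rightarrow> real^6"
    and V :: "real^'k^6"
  assumes "\<forall>j\<in>{1..N}. is_spatial_transform (XT j)"
    and "\<forall>j\<in>{1..N}. \<forall>x. is_spatial_transform (XJ j x)"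
    and "\<forall>j\<in>{1..N}. XJ j 0 = mat 1"
    and "\<forall>j\<in>{1..N}. \<forall>x. (XJ j has_vector_derivative (- (crossm (Phi j) ** XJ j x))) (at x)"
    and "i \<in> {1..N}"
    and "Range V = attainable N XJ XT Phi (i - 1)"
  shows "Range (augctrl (crossm (Phi i)) (Phi i) (XT i ** V)) = attainable N XJ XT Phi i"
proof -
  obtain n where i: "i = Suc n" using assms(5) by (cases i) auto
  let ?S = "{vel XJ XT Phi n q qd | q qd. True}"
  let ?W = "(*v) (XT i) ` ?S"
  have dX: "\<And>t. (XJ i has_vector_derivative (- (crossm (Phi i) ** XJ i t))) (at t)"
    and X0: "XJ i 0 = mat 1"
    using assms(3-5) by auto
  have "Range (XT i ** V) = span ?W"
    using assms(6) i
    by (simp add: Range_matrix_mult attainable_def linear_span_image[symmetric] matrix_vector_mul_linear)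
  then have "Range (augctrl (crossm (Phi i)) (Phi i) (XT i ** V))
      = span ({Phi i} \<union> krylov (crossm (Phi i)) ?W 6)"
    by (simp add: Range_augctrl krylov_span)
  also have "krylov (crossm (Phi i)) ?W 6 = span {XJ i t *v w | t w. w \<in> ?W}"
    using span_matrix_flow_orbits[OF dX X0, of ?W] by simp
  also have "span ({Phi i} \<union> span {XJ i t *v w | t w. w \<in> ?W}) = attainable N XJ XT Phi i"
    unfolding span_Un_span i by (rule attainable_Suc[symmetric])
  finally show ?thesis .
qed

end
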